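(* For all $i\in\mathbb Z$, $$\phi(\psi_i)=\alpha_i\psi_i+(1-\alpha_i\beta_i)\sum_{j=0}^\infty\Bigl(\prod_{k=1}^j-\beta_{i+k}\Bigr)\psi_{i+j+1},$$ $$\phi^{-1}(\psi_i)=\beta_i\psi_i+(1-\alpha_i\beta_i)\sum_{j=0}^\infty\Bigl(\prod_{k=1}^j-\alpha_{i-k}\Bigr)\psi_{i-j-1},$$ $$\phi(\psi_i^* )=\beta_i\psi_i^*+\sum_{j=0}^\infty\Bigl(\prod_{k=1}^j-\alpha_{i+k}\Bigr)(1-\alpha_{i+j+1}\beta_{i+j+1})\,\psi_{i+j+1}^*,$$ $$\phi^{-1}(\psi_i^* )=\alpha_i\psi_i^*+\sum_{j=0}^\infty\Bigl(\prod_{k=1}^j-\beta_{i-k}\Bigr)(1-\alpha_{i-j-1}\beta_{i-j-1})\,\psi_{i-j-1}^*.$$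
   Context: $\boldsymbol\alpha=(\alpha_i)_{i\in\mathbb Z}$, $\boldsymbol\beta=(\beta_i)_{i\in\mathbb Z}$ are sequences in $\mathbb C$ with $\alpha_i=0$ for $i\ll0$ and $\beta_i=0$ for $i\gg0$ (the paper's provisional assumption). For $k\in\mathbb Z$, $(z;\boldsymbol\alpha)^k=\prod_{i=1}^k(1-z\alpha_i)$ if $k\ge 0$ and $\prod_{i=k+1}^{0}(1-z\alpha_i)^{-1}$ if $k<0$; $(z|\boldsymbol\beta)^k=\prod_{i=1}^k(z-\beta_i)$ if $k\ge0$ and $\prod_{i=k+1}^0(z-\beta_i)^{-1}$ if $k<0$. The Clifford algebra is generated by $\psi_i,\psi_i^*$ ($i\in\mathbb Z$) with $[\psi_i,\psi_j]_+=[\psi_i^*,\psi_j^*]_+=0$, $[\psi_i,\psi_j^*]_+=\delta_{ij}$; formal infinite linear combinations of the generators are allowed. Deformed fields: $\psi(z|\boldsymbol\alpha;\boldsymbol\beta)=\sum_i z\frac{(z|\boldsymbol\beta)^{i-1}}{(z;\boldsymbol\alpha)^i}\psi_i$, $\psi^*(w|\boldsymbol\alpha;\boldsymbol\beta)=\sum_j(1-\alpha_j\beta_j)\frac{(w;\boldsymbol\alpha)^{j-1}}{(w|\boldsymbol\beta)^j}\psi_j^*$. The map $\phi$ is the "automorphism" given by $$\phi:\ \psi(z|\boldsymbol\alpha;\boldsymbol\beta)\mapsto z^{-1}\psi(z|\boldsymbol\alpha;\boldsymbol\beta),\qquad \psi^*(w|\boldsymbol\alpha;\boldsymbol\beta)\mapsto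 w\,\psi^*(w|\boldsymbol\alpha;\boldsymbol\beta),$$ and $\phi^{-1}$ by $\psi(z|\boldsymbol\alpha;\boldsymbol\beta)\mapsto z\,\psi(z|\boldsymbol\alpha;\boldsymbol\beta)$, $\psi^*(w|\boldsymbol\alpha;\boldsymbol\beta)\mapsto w^{-1}\psi^*(w|\boldsymbol\alpha;\boldsymbol\beta)$. Its values on generators are obtained by comparing coefficients of the functions $z(z|\boldsymbol\beta)^{i-1}/(z;\boldsymbol\alpha)^i$, respectively $(w;\boldsymbol\alpha)^{j-1}/(w|\boldsymbol\beta)^j$; explicitly, with the counterclockwise contour $|z|=r$, $|\beta_i|<r<|\alpha_j^{-1}|$ for all $i,j$, $$\phi^{\pm1}(\psi_i)=(1-\alpha_i\beta_i)\oint\frac{(z;\boldsymbol\alpha)^{i-1}}{(z|\boldsymbol\beta)^i}\,z^{\mp1}\,\psi(z|\boldsymbol\alpha;\boldsymbol\beta)\frac{dz}{2\pi\sqrt{-1}\,z},\qquad \phi^{\pm1}(\psi_i^* )=\oint\frac{(w|\boldsymbol\beta)^{i-1}}{(w;\boldsymbol\alpha)^i}\,w^{\pm1}\,\psi^*(w|\boldsymbol\alpha;\boldsymbol\beta)\frac{dw}{2\pi\sqrt{-1}},$$ the integrals being taken termwise. Empty products equal $1$. *)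

theory Defs
  imports "HOL-Complex_Analysis.Complex_Analysis" "HOL-Library.Function_Algebras"
begin

definition pow_alpha :: "complex \<Rightarrow> (int \<Rightarrow> complex) \<Rightarrow> int \<Rightarrow> complex" where
  "pow_alpha z \<alpha> k =
     (if k \<ge> 0 then (\<Prod>i\<in>{1..k}. 1 - z * \<alpha> i) else (\<Prod>i\<in>{k+1..0}. inverse (1 - z * \<alpha> i)))"

definition pow_beta :: "complex \<Rightarrow> (int \<Rightarrow> complex) \<Rightarrow> int \<Rightarrow> complex" where
  "pow_beta z \<beta> k =
     (if k \<ge> 0 then (\<Prod>i\<in>{1..k}. z - \<beta> i) else (\<Prod>i\<in>{k+1..0}. inverse (z - \<beta> i)))"

datatype generator = Psi int | PsiStar int

text \<open>
  All identities below are linear in the generators of the Clifford algebra, so they live in the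
  space of formal, possibly infinite, linear combinations of generators.  Such a combination is its
  family of coefficients, and two combinations are equal iff all coefficients agree.  Addition
  is the pointwise one of \<^theory>\<open>HOL-Library.Function_Algebras\<close>.
\<close>

type_synonym formal_comb = "generator \<Rightarrow> complex"

definition single :: "generator \<Rightarrow> formal_comb" where
  "single g = (\<lambda>h. if h = g then 1 else 0)"

abbreviation psi :: "int \<Rightarrow> formal_comb" where "psi i \<equiv> single (Psi i)"
abbreviation psi_star :: "int \<Rightarrow> formal_comb" where "psi_star i \<equiv> single (PsiStar i)"

definition scale :: "complex \<Rightarrow> formal_comb \<Rightarrow> formal_comb" (infixr "*\<^sub>F" 75) where
  "c *\<^sub>F v = (\<lambda>g. c * v g)"

text \<open>
  Infinite formal sums are formed coefficientwise.  This is meaningful for locally finite families,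
  i.e. when each generator has a nonzero coefficient in only finitely many \<^term>\<open>F j\<close>; it is
  only applied to families in which distinct indices carry distinct generators.
\<close>

definition formal_sum :: "('i \<Rightarrow> formal_comb) \<Rightarrow> formal_comb" where
  "formal_sum F = (\<lambda>g. \<Sum>j | F j g \<noteq> 0. F j g)"

definition psi_field ::
  "(int \<Rightarrow> complex) \<Rightarrow> (int \<Rightarrow> complex) \<Rightarrow> complex \<Rightarrow> formal_comb" where
  "psi_field \<alpha> \<beta> z =
     formal_sum (\<lambda>i. (z * pow_beta z \<beta> (i - 1) / pow_alpha z \<alpha> i) *\<^sub>F psi i)"

definition psi_star_field ::
  "(int \<Rightarrow> complex) \<Rightarrow> (int \<Rightarrow> complex) \<Rightarrow> complex \<Rightarrow> formal_comb" where
  "psi_star_field \<alpha> \<beta> w =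
     formal_sum (\<lambda>j. ((1 - \<alpha> j * \<beta> j) * pow_alpha w \<alpha> (j - 1) / pow_beta w \<beta> j) *\<^sub>F psi_star j)"

definition termwise_integral :: "real \<Rightarrow> (complex \<Rightarrow> formal_comb) \<Rightarrow> formal_comb" where
  "termwise_integral r F =
     (\<lambda>g. contour_integral (circlepath 0 r) (\<lambda>z. F z g / (2 * of_real pi * \<i>)))"

text \<open>
  \<open>phi_power \<alpha> \<beta> r s g\<close> is the value on the generator \<open>g\<close> of the map $\phi^s$, where
  $s = \pm 1$; the map $\phi$ multiplies the field of the \<open>Psi i\<close> by $z^{-1}$ and that of the
  \<open>PsiStar i\<close> by $w$.  Comparing coefficients of the functions of $z$ and $w$ in these
  fields means integrating against the dual functions over the circle of radius \<open>r\<close>, which has to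
  separate all \<open>\<beta> i\<close> (inside) from all \<open>1 / \<alpha> j\<close> (outside).
\<close>

primrec phi_power ::
  "(int \<Rightarrow> complex) \<Rightarrow> (int \<Rightarrow> complex) \<Rightarrow> real \<Rightarrow> int \<Rightarrow> generator \<Rightarrow> formal_comb" where
  "phi_power \<alpha> \<beta> r s (Psi i) =
     (1 - \<alpha> i * \<beta> i) *\<^sub>F termwise_integral r (\<lambda>z.
       (pow_alpha z \<alpha> (i - 1) / pow_beta z \<beta> i * z powi (- s) / z) *\<^sub>F psi_field \<alpha> \<beta> z)"
| "phi_power \<alpha> \<beta> r s (PsiStar i) =
     termwise_integral r (\<lambda>w.
       (pow_beta w \<beta> (i - 1) / pow_alpha w \<alpha> i * w powi s) *\<^sub>F psi_star_field \<alpha> \<beta> w)"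

abbreviation phi ::
  "(int \<Rightarrow> complex) \<Rightarrow> (int \<Rightarrow> complex) \<Rightarrow> real \<Rightarrow> generator \<Rightarrow> formal_comb" where
  "phi \<alpha> \<beta> r \<equiv> phi_power \<alpha> \<beta> r 1"

abbreviation phi_inv ::
  "(int \<Rightarrow> complex) \<Rightarrow> (int \<Rightarrow> complex) \<Rightarrow> real \<Rightarrow> generator \<Rightarrow> formal_comb" where
  "phi_inv \<alpha> \<beta> r \<equiv> phi_power \<alpha> \<beta> r (- 1)"

end

theory Submission
  imports Defs
begin

text \<open>
  The coefficient of \<^term>\<open>psi m\<close> in $\phi^s(\psi_i)$ is $(1-\alpha_i\beta_i)$ times the integral
  $$K_{-s}(i,m) = \oint z^{-s}\, \frac{(z;\alpha)^{i-1}}{(z;\alpha)^m}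
      \frac{(z|\beta)^{m-1}}{(z|\beta)^i} \frac{dz}{2\pi\sqrt{-1}},$$
  and the coefficient of \<^term>\<open>psi_star m\<close> in $\phi^s(\psi_i^*)$ is $(1-\alpha_m\beta_m)\, K_s(m,i)$.
  So all four formulas express the values of the one family $K_n(i,m)$
  (\<open>contour_pairing\<close>) for $n = \pm 1$.

  When $i < m$, the signed powers leave $\prod_{i<k<m}(z-\beta_k)$ over
  $\prod_{i\le k\le m}(1-z\alpha_k)$, which has no pole inside the circle. Hence $K_1$ vanishes and
  $K_{-1}$ is the value at the origin, $\prod_{i<k<m}(-\beta_k)$. When $i = m$, only
  $1/((1-z\alpha_i)(z-\beta_i))$ is left, and Cauchy's formula at $\beta_i$ gives $K_1(i,i)$.

  For the remaining values all poles are inside the circle, and one looks from infinity instead. The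
  substitution $z = 1/u$ turns a factor $1-z\alpha_k$ into $u^{-1}(u-\alpha_k)$ and a factor
  $z-\beta_k$ into $u^{-1}(1-u\beta_k)$, so it exchanges the roles of $\alpha$ and $\beta$, of inside
  and outside, of $i$ and $m$, and of $n$ and $-n$ (\<open>contour_pairing_inversion\<close>); all powers of
  $u$ from the factors cancel against $dz = -u^{-2}\,du$ up to orientation. This symmetry reduces every
  other case to the ones above.
\<close>

section \<open>Products with a signed number of factors\<close>

text \<open>
  Both kinds of deformed powers are instances of this product, which is the solution of
  $F(k) = F(k-1) f(k)$ with $F(0) = 1$ on all of the integers, as long as $f$ has no zero.
\<close>

definition signed_prod :: "(int \<Rightarrow> 'a::field) \<Rightarrow> int \<Rightarrow> 'a" where
  "signed_prod f k =
     (if k \<ge> 0 then (\<Prod>i\<in>{1..k}. f i) else (\<Prod>i\<in>{k+1..0}. inverse (f i)))"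

lemma pow_alpha_eq_signed_prod: "pow_alpha z \<alpha> = signed_prod (\<lambda>i. 1 - z * \<alpha> i)"
  by (auto simp: pow_alpha_def signed_prod_def)

lemma pow_beta_eq_signed_prod: "pow_beta z \<beta> = signed_prod (\<lambda>i. z - \<beta> i)"
  by (auto simp: pow_beta_def signed_prod_def)

lemma signed_prod_nonzero:
  assumes "\<And>i. f i \<noteq> 0"
  shows "signed_prod f k \<noteq> 0"
  using assms by (auto simp: signed_prod_def)

lemma signed_prod_step:
  assumes "\<And>i. f i \<noteq> 0"
  shows "signed_prod f k = signed_prod f (k - 1) * f k"
proof (cases "k \<ge> 1")
  case True
  then have "{1..k} = insert k {1..k-1}" by auto
  with True show ?thesis by (simp add: signed_prod_def)
next
  case False
  then have *: "{k..0} = insert k {k+1..0}" by auto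
  have "signed_prod f (k - 1) = (\<Prod>i\<in>{k..0}. inverse (f i))"
    using False by (simp add: signed_prod_def)
  also have "\<dots> = inverse (f k) * (\<Prod>i\<in>{k+1..0}. inverse (f i))"
    unfolding * by simp
  also have "(\<Prod>i\<in>{k+1..0}. inverse (f i)) = signed_prod f k"
    using False by (auto simp: signed_prod_def)
  finally show ?thesis using assms[of k] by simp
qed

text \<open>
  The ratio of two signed products is an ordinary product even if the range straddles the origin.
  The contour integrals see the deformed powers only through such ratios.
\<close>

lemma signed_prod_split:
  assumes "\<And>i. f i \<noteq> 0" and "m \<le> n"
  shows "signed_prod f n = signed_prod f m * (\<Prod>i\<in>{m+1..n}. f i)"
  using assms(2)
proof (induction n rule: int_ge_induct)
  case (step n)
  then have "{m+1..n+1} = insert (n+1) {m+1..n}" by auto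
  with step signed_prod_step[of f "n + 1", OF assms(1)] show ?case by simp
qed simp

text \<open>
  Passing from $z$ to $1/z$ pulls $1/z$ out of each factor of a deformed power; this counts how
  many are pulled out.
\<close>

lemma signed_prod_scale:
  assumes "\<And>i. f i \<noteq> 0" and "c \<noteq> 0"
  shows "signed_prod (\<lambda>i. c * f i) k = c powi k * signed_prod f k"
proof -
  have nz: "\<And>i. c * f i \<noteq> 0" using assms by simp
  show ?thesis
  proof (induction k rule: int_induct[where k = 0])
    case (step1 k)
    then show ?case
      using signed_prod_step[of f "k+1", OF assms(1)]
        signed_prod_step[of "\<lambda>i. c * f i" "k+1", OF nz] \<open>c \<noteq> 0\<close>
      by (simp add: power_int_add)
  next
    case (step2 k)
    then show ?case
      using signed_prod_step[of f k, OF assms(1)] assms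
        signed_prod_step[of "\<lambda>i. c * f i" k, OF nz]
      by (simp add: power_int_diff field_simps)
  qed (simp add: signed_prod_def)
qed

lemma continuous_on_signed_prod:
  fixes f :: "'a::topological_space \<Rightarrow> int \<Rightarrow> 'b::real_normed_field"
  assumes "\<And>i. continuous_on S (\<lambda>z. f z i)" and "\<And>z i. z \<in> S \<Longrightarrow> f z i \<noteq> 0"
  shows "continuous_on S (\<lambda>z. signed_prod (f z) k)"
  using assms by (cases "k \<ge> 0") (auto simp: signed_prod_def intro!: continuous_intros)


section \<open>Contour integrals over circles\<close>

text \<open>
  Inversion reverses the angle, so it carries the parameter interval $[0,2\pi]$ to $[-2\pi,0]$.
\<close>

lemma circlepath_eq_part_circlepath_shifted:
  "circlepath z r = part_circlepath z r (- (2 * pi)) 0"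
proof
  fix x
  have "exp (\<i> * complex_of_real (linepath (- (2 * pi)) 0 x)) = exp (2 * pi * \<i> * x)"
    unfolding exp_eq by (intro exI[of _ "-1"]) (simp add: linepath_def algebra_simps)
  then show "circlepath z r x = part_circlepath z r (- (2 * pi)) 0 x"
    by (simp add: circlepath part_circlepath_def)
qed

text \<open>
  Substitution $z = 1/u$: the sign of $dz = -u^{-2}\,du$ is absorbed by restoring the
  counterclockwise orientation. In terms of the angle, both sides are the same integral up to a
  reflection, so the identity holds for arbitrary integrands.
\<close>

lemma contour_integral_circlepath_inversion:
  assumes "r > 0"
  shows "contour_integral (circlepath 0 r) f =
    contour_integral (circlepath 0 (inverse r)) (\<lambda>u. f (inverse u) / u\<^sup>2)"
proof -
  let ?h = "\<lambda>t. f (r * cis t) * r * \<i> * cis t"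
  have "contour_integral (circlepath 0 r) f = integral {0..2*pi} ?h"
    unfolding circlepath_def by (subst contour_integral_part_circlepath_eq) auto
  also have "\<dots> = integral {- (2 * pi)..-0} (\<lambda>t. ?h (- t))"
    by (rule Henstock_Kurzweil_Integration.integral_reflect_real[symmetric])
  also have "\<dots> = integral {- (2 * pi)..0}
      (\<lambda>t. f (inverse (inverse r * cis t)) / (inverse r * cis t)\<^sup>2 * inverse r * \<i> * cis t)"
    using assms unfolding minus_zero
    by (intro integral_cong) (auto simp: field_simps power2_eq_square simp flip: cis_inverse)
  also have "\<dots> = contour_integral (circlepath 0 (inverse r)) (\<lambda>u. f (inverse u) / u\<^sup>2)"
    unfolding circlepath_eq_part_circlepath_shifted
    by (subst contour_integral_part_circlepath_eq) auto
  finally show ?thesis .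
qed

lemma contour_integral_circlepath_Cauchy:
  assumes "f holomorphic_on cball z r" and "norm (w - z) < r"
  shows "contour_integral (circlepath z r) (\<lambda>u. f u / (u - w) / (2 * of_real pi * \<i>)) = f w"
proof -
  have "((\<lambda>u. f u / (u - w) / (2 * of_real pi * \<i>)) has_contour_integral
      (2 * of_real pi * \<i> * f w) / (2 * of_real pi * \<i>)) (circlepath z r)"
    by (intro has_contour_integral_div Cauchy_integral_circlepath_simple assms)
  then show ?thesis by (auto dest: contour_integral_unique)
qed


section \<open>The pairing of the field coefficients with the dual functions\<close>

definition contour_pairing ::
  "(int \<Rightarrow> complex) \<Rightarrow> (int \<Rightarrow> complex) \<Rightarrow> real \<Rightarrow> int \<Rightarrow> int \<Rightarrow> int \<Rightarrow> complex" where
  "contour_pairing \<alpha> \<beta> r n i m =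
     contour_integral (circlepath 0 r) (\<lambda>z. z powi n *
       (pow_alpha z \<alpha> (i - 1) / pow_alpha z \<alpha> m) * (pow_beta z \<beta> (m - 1) / pow_beta z \<beta> i)
       / (2 * of_real pi * \<i>))"

text \<open>
  The circle has to run outside all \<^term>\<open>\<beta> i\<close> and inside all \<^term>\<open>inverse (\<alpha> i)\<close>. The second
  condition bounds \<^term>\<open>\<alpha> i\<close> itself, which covers vanishing \<^term>\<open>\<alpha> i\<close> and makes the
  condition visibly symmetric under inversion.
\<close>

definition separates :: "real \<Rightarrow> (int \<Rightarrow> complex) \<Rightarrow> (int \<Rightarrow> complex) \<Rightarrow> bool" where
  "separates r \<alpha> \<beta> \<longleftrightarrow> (\<forall>i. norm (\<beta> i) < r) \<and> (\<forall>i. norm (\<alpha> i) < inverse r)"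

lemma separates_pos: "separates r \<alpha> \<beta> \<Longrightarrow> r > 0"
  by (meson separates_def norm_ge_zero order_le_less_trans)

lemma separates_inversion: "separates r \<alpha> \<beta> \<Longrightarrow> separates (inverse r) \<beta> \<alpha>"
  by (simp add: separates_def)

text \<open>
  This holds on the whole disc, since Cauchy's theorem is applied with these factors in the
  denominator; for the other factors below only the circle itself matters.
\<close>

lemma separates_alpha_factor:
  assumes "separates r \<alpha> \<beta>" and "norm z \<le> r"
  shows "1 - z * \<alpha> i \<noteq> 0"
proof -
  have "r > 0" using assms(1) by (rule separates_pos)
  have "norm (z * \<alpha> i) \<le> r * norm (\<alpha> i)"
    using assms(2) by (simp add: norm_mult mult_right_mono)
  also have "\<dots> < 1"
    using assms(1) \<open>r > 0\<close> by (simp add: separates_def field_simps)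
  finally show ?thesis by auto
qed

lemma separates_beta_factor:
  assumes "separates r \<alpha> \<beta>" and "norm z = r"
  shows "z - \<beta> i \<noteq> 0"
  using assms by (auto simp: separates_def)

lemma separates_prod_nonzero:
  assumes "separates r \<alpha> \<beta>"
  shows "1 - \<alpha> i * \<beta> i \<noteq> 0"
  using separates_alpha_factor[OF assms, of "\<beta> i" i] assms
  by (auto simp: separates_def less_imp_le mult.commute)

text \<open>
  Under $z = 1/u$ the integrand of $K_n(i,m)$ for $(\alpha,\beta)$ becomes that of $K_{-n}(m,i)$ for
  $(\beta,\alpha)$. The exponents on the powers of $1/u$ add up to $(i-1)-m+(m-1)-i = -2$, and the
  resulting factor $u^2$ cancels the Jacobian.
\<close>

lemma contour_pairing_inversion:
  assumes sep: "separates r \<alpha> \<beta>"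
  shows "contour_pairing \<alpha> \<beta> r n i m = contour_pairing \<beta> \<alpha> (inverse r) (- n) m i"
proof -
  have "r > 0" using sep by (rule separates_pos)
  have integrand: "inverse u powi n *
      (pow_alpha (inverse u) \<alpha> (i - 1) / pow_alpha (inverse u) \<alpha> m) *
      (pow_beta (inverse u) \<beta> (m - 1) / pow_beta (inverse u) \<beta> i) / (2 * of_real pi * \<i>) / u\<^sup>2 =
    u powi (- n) * (pow_alpha u \<beta> (m - 1) / pow_alpha u \<beta> i) *
      (pow_beta u \<alpha> (i - 1) / pow_beta u \<alpha> m) / (2 * of_real pi * \<i>)"
    if "norm u = inverse r" for u
  proof -
    have u: "u \<noteq> 0" using that \<open>r > 0\<close> by auto
    have nzb: "u - \<alpha> k \<noteq> 0" for k
      using separates_beta_factor[OF separates_inversion[OF sep] that] .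
    have nza: "1 - u * \<beta> k \<noteq> 0" for k
      using separates_alpha_factor[OF separates_inversion[OF sep]] that by simp
    have "(\<lambda>k. 1 - inverse u * \<alpha> k) = (\<lambda>k. inverse u * (u - \<alpha> k))"
      using u by (auto simp: field_simps)
    then have a: "pow_alpha (inverse u) \<alpha> k = inverse u powi k * pow_beta u \<alpha> k" for k
      unfolding pow_alpha_eq_signed_prod pow_beta_eq_signed_prod
      using signed_prod_scale[of "\<lambda>k. u - \<alpha> k" "inverse u" k, OF nzb] u by simp
    have "(\<lambda>k. inverse u - \<beta> k) = (\<lambda>k. inverse u * (1 - u * \<beta> k))"
      using u by (auto simp: field_simps)
    then have b: "pow_beta (inverse u) \<beta> k = inverse u powi k * pow_alpha u \<beta> k" for k
      unfolding pow_alpha_eq_signed_prod pow_beta_eq_signed_prod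
      using signed_prod_scale[of "\<lambda>k. 1 - u * \<beta> k" "inverse u" k, OF nza] u by simp
    have step: "inverse u powi (k - 1) = inverse u powi k * u" for k
      using u by (subst power_int_diff) (auto simp: divide_inverse)
    define P Q where "P = inverse u powi i" and "Q = inverse u powi m"
    have "P \<noteq> 0" "Q \<noteq> 0" using u by (auto simp: P_def Q_def)
    moreover have "inverse u powi n = u powi (- n)"
      by (simp add: power_int_minus power_int_inverse)
    ultimately show ?thesis
      unfolding a b step P_def[symmetric] Q_def[symmetric]
      using u by (simp add: power2_eq_square mult_ac)
  qed
  show ?thesis
    unfolding contour_pairing_def
    by (subst contour_integral_circlepath_inversion[OF \<open>r > 0\<close>], rule contour_integral_cong)
      (use integrand \<open>r > 0\<close> in \<open>auto simp: path_image_circlepath\<close>)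
qed

text \<open>
  The integrand is $z^{\pm 1}$ times a function holomorphic on the disc. Both integrals are read off
  from Cauchy's formula at the origin, the second one by writing $z g(z) = z^2 g(z)/z$.
\<close>

lemma contour_pairing_above:
  assumes sep: "separates r \<alpha> \<beta>" and "i < m"
  shows "contour_pairing \<alpha> \<beta> r (- 1) i m = (\<Prod>k\<in>{i+1..m-1}. - \<beta> k)"
    and "contour_pairing \<alpha> \<beta> r 1 i m = 0"
proof -
  have "r > 0" using sep by (rule separates_pos)
  define g where "g = (\<lambda>z. (\<Prod>k\<in>{i+1..m-1}. z - \<beta> k) / (\<Prod>k\<in>{i..m}. 1 - z * \<alpha> k))"
  have holo: "g holomorphic_on cball 0 r"
    unfolding g_def using separates_alpha_factor[OF sep]
    by (intro holomorphic_intros) auto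
  have ratio: "(pow_alpha z \<alpha> (i - 1) / pow_alpha z \<alpha> m) *
      (pow_beta z \<beta> (m - 1) / pow_beta z \<beta> i) = g z" if z: "norm z = r" for z
  proof -
    have nza: "1 - z * \<alpha> k \<noteq> 0" for k using separates_alpha_factor[OF sep] z by simp
    have nzb: "z - \<beta> k \<noteq> 0" for k using separates_beta_factor[OF sep z] .
    have "pow_alpha z \<alpha> m = pow_alpha z \<alpha> (i - 1) * (\<Prod>k\<in>{i..m}. 1 - z * \<alpha> k)"
      unfolding pow_alpha_eq_signed_prod
      using signed_prod_split[of "\<lambda>k. 1 - z * \<alpha> k" "i - 1" m, OF nza] \<open>i < m\<close> by simp
    moreover have "pow_beta z \<beta> (m - 1) = pow_beta z \<beta> i * (\<Prod>k\<in>{i+1..m-1}. z - \<beta> k)"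
      unfolding pow_beta_eq_signed_prod
      using signed_prod_split[of "\<lambda>k. z - \<beta> k" i "m - 1", OF nzb] \<open>i < m\<close> by simp
    moreover have "pow_alpha z \<alpha> (i - 1) \<noteq> 0" "pow_beta z \<beta> i \<noteq> 0"
      unfolding pow_alpha_eq_signed_prod pow_beta_eq_signed_prod
      using nza nzb by (auto intro!: signed_prod_nonzero)
    ultimately show ?thesis by (simp add: g_def)
  qed
  have "contour_pairing \<alpha> \<beta> r (- 1) i m =
      contour_integral (circlepath 0 r) (\<lambda>z. g z / (z - 0) / (2 * of_real pi * \<i>))"
    unfolding contour_pairing_def using \<open>r > 0\<close>
    by (intro contour_integral_cong)
      (auto simp: mult.assoc ratio power_int_minus field_simps simp flip: ratio)
  also have "\<dots> = g 0"
    by (rule contour_integral_circlepath_Cauchy) (use holo \<open>r > 0\<close> in auto)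
  finally show "contour_pairing \<alpha> \<beta> r (- 1) i m = (\<Prod>k\<in>{i+1..m-1}. - \<beta> k)"
    by (simp add: g_def)
  have "contour_pairing \<alpha> \<beta> r 1 i m =
      contour_integral (circlepath 0 r) (\<lambda>z. (z\<^sup>2 * g z) / (z - 0) / (2 * of_real pi * \<i>))"
    unfolding contour_pairing_def using \<open>r > 0\<close>
    by (intro contour_integral_cong)
      (auto simp: power2_eq_square simp flip: ratio)
  also have "\<dots> = 0\<^sup>2 * g 0"
    by (rule contour_integral_circlepath_Cauchy)
      (use holo \<open>r > 0\<close> in \<open>auto intro!: holomorphic_intros\<close>)
  finally show "contour_pairing \<alpha> \<beta> r 1 i m = 0" by simp
qed

text \<open>
  Here $\beta_i$ is the only pole inside the circle. For $n = -1$ there would be a second one at the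
  origin; that value comes from inversion instead.
\<close>

lemma contour_pairing_diag:
  assumes sep: "separates r \<alpha> \<beta>"
  shows "contour_pairing \<alpha> \<beta> r 1 i i = \<beta> i / (1 - \<alpha> i * \<beta> i)"
proof -
  have "r > 0" using sep by (rule separates_pos)
  have ratio: "(pow_alpha z \<alpha> (i - 1) / pow_alpha z \<alpha> i) *
      (pow_beta z \<beta> (i - 1) / pow_beta z \<beta> i) = 1 / (1 - z * \<alpha> i) / (z - \<beta> i)"
    if z: "norm z = r" for z
  proof -
    have nza: "1 - z * \<alpha> k \<noteq> 0" for k using separates_alpha_factor[OF sep] z by simp
    have nzb: "z - \<beta> k \<noteq> 0" for k using separates_beta_factor[OF sep z] .
    show ?thesis
      unfolding pow_alpha_eq_signed_prod pow_beta_eq_signed_prod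
      using signed_prod_step[of "\<lambda>k. 1 - z * \<alpha> k" i, OF nza]
        signed_prod_step[of "\<lambda>k. z - \<beta> k" i, OF nzb]
        signed_prod_nonzero[of "\<lambda>k. 1 - z * \<alpha> k" "i - 1", OF nza]
        signed_prod_nonzero[of "\<lambda>k. z - \<beta> k" "i - 1", OF nzb]
      by simp
  qed
  have "contour_pairing \<alpha> \<beta> r 1 i i =
      contour_integral (circlepath 0 r)
        (\<lambda>z. z / (1 - z * \<alpha> i) / (z - \<beta> i) / (2 * of_real pi * \<i>))"
    unfolding contour_pairing_def using \<open>r > 0\<close>
    by (intro contour_integral_cong refl, subst mult.assoc, subst ratio) auto
  also have "\<dots> = \<beta> i / (1 - \<beta> i * \<alpha> i)"
    by (rule contour_integral_circlepath_Cauchy)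
      (use sep separates_alpha_factor[OF sep] in
        \<open>auto intro!: holomorphic_intros simp: separates_def\<close>)
  finally show ?thesis by (simp add: mult.commute)
qed

lemma contour_pairing_minus_one:
  assumes sep: "separates r \<alpha> \<beta>"
  shows "contour_pairing \<alpha> \<beta> r (- 1) i m =
    (if i < m then \<Prod>k\<in>{i+1..m-1}. - \<beta> k
     else if i = m then \<alpha> i / (1 - \<alpha> i * \<beta> i) else 0)"
proof -
  note inv = contour_pairing_inversion[OF sep, of "- 1" i m]
  note sep' = separates_inversion[OF sep]
  show ?thesis
    using contour_pairing_above[OF sep, of i m] contour_pairing_above[OF sep', of m i]
      contour_pairing_diag[OF sep', of i] inv
    by (auto simp: mult.commute)
qed

lemma contour_pairing_one:
  assumes sep: "separates r \<alpha> \<beta>"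
  shows "contour_pairing \<alpha> \<beta> r 1 i m =
    (if m < i then \<Prod>k\<in>{m+1..i-1}. - \<alpha> k
     else if i = m then \<beta> i / (1 - \<alpha> i * \<beta> i) else 0)"
  using contour_pairing_minus_one[OF separates_inversion[OF sep], of m i]
    contour_pairing_inversion[OF sep, of 1 i m]
  by (auto simp: mult.commute)


section \<open>Coefficients of formal sums\<close>

lemma scale_apply: "(c *\<^sub>F v) g = c * v g"
  by (simp add: scale_def)

lemma single_apply: "single g h = (if h = g then 1 else 0)"
  by (simp add: single_def)

lemma formal_sum_single:
  assumes "inj g"
  shows "formal_sum (\<lambda>j. c j *\<^sub>F single (g j)) (g j) = c j"
proof -
  have "{k. (c k *\<^sub>F single (g k)) (g j) \<noteq> 0} = (if c j = 0 then {} else {j})"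
    using assms by (auto simp: scale_def single_def inj_eq)
  then show ?thesis by (simp add: formal_sum_def scale_def single_def)
qed

lemma formal_sum_single_outside:
  assumes "h \<notin> range g"
  shows "formal_sum (\<lambda>j. c j *\<^sub>F single (g j)) h = 0"
proof -
  have "{k. (c k *\<^sub>F single (g k)) h \<noteq> 0} = {}"
    using assms by (auto simp: scale_def single_def)
  then show ?thesis by (simp add: formal_sum_def)
qed

lemma formal_sum_ascending:
  assumes "inj G"
  shows "formal_sum (\<lambda>j::nat. c j *\<^sub>F single (G (i + int j + 1))) (G m) =
    (if i < m then c (nat (m - i - 1)) else 0)"
proof (cases "i < m")
  case True
  have "inj (\<lambda>j::nat. G (i + int j + 1))"
    using assms by (auto intro!: injI dest: injD)
  from formal_sum_single[OF this, of c "nat (m - i - 1)"] True show ?thesis by simp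
next
  case False
  then show ?thesis
    using assms by (auto intro!: formal_sum_single_outside dest: injD)
qed

lemma formal_sum_descending:
  assumes "inj G"
  shows "formal_sum (\<lambda>j::nat. c j *\<^sub>F single (G (i - int j - 1))) (G m) =
    (if m < i then c (nat (i - m - 1)) else 0)"
proof (cases "m < i")
  case True
  have "inj (\<lambda>j::nat. G (i - int j - 1))"
    using assms by (auto intro!: injI dest: injD)
  from formal_sum_single[OF this, of c "nat (i - m - 1)"] True show ?thesis by simp
next
  case False
  then show ?thesis
    using assms by (auto intro!: formal_sum_single_outside dest: injD)
qed

lemma prod_ascending:
  "(\<Prod>k=1..nat (m - i - 1). f (i + int k)) = (\<Prod>k\<in>{i+1..m-1}. f k)"
  by (rule prod.reindex_bij_witness[where i = "\<lambda>k. nat (k - i)" and j = "\<lambda>k. i + int k"]) auto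

lemma prod_descending:
  "(\<Prod>k=1..nat (i - m - 1). f (i - int k)) = (\<Prod>k\<in>{m+1..i-1}. f k)"
  by (rule prod.reindex_bij_witness[where i = "\<lambda>k. nat (i - k)" and j = "\<lambda>k. i - int k"]) auto

lemma inj_generator: "inj Psi" "inj PsiStar"
  by (auto simp: inj_def)


section \<open>The values on generators\<close>

lemma psi_field_apply:
  "psi_field \<alpha> \<beta> z (Psi m) = z * pow_beta z \<beta> (m - 1) / pow_alpha z \<alpha> m"
  "psi_field \<alpha> \<beta> z (PsiStar m) = 0"
  unfolding psi_field_def
  by (rule formal_sum_single[OF inj_generator(1)], rule formal_sum_single_outside) auto

lemma psi_star_field_apply:
  "psi_star_field \<alpha> \<beta> w (PsiStar m) =
     (1 - \<alpha> m * \<beta> m) * pow_alpha w \<alpha> (m - 1) / pow_beta w \<beta> m"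
  "psi_star_field \<alpha> \<beta> w (Psi m) = 0"
  unfolding psi_star_field_def
  by (rule formal_sum_single[OF inj_generator(2)], rule formal_sum_single_outside) auto

text \<open>
  On a circle around the origin, the factor $z$ of the field cancels the $1/z$ of the measure
  $dz/z$, leaving the integrand of the pairing.
\<close>

lemma phi_power_Psi_apply:
  assumes sep: "separates r \<alpha> \<beta>"
  shows "phi_power \<alpha> \<beta> r s (Psi i) (Psi m) =
      (1 - \<alpha> i * \<beta> i) * contour_pairing \<alpha> \<beta> r (- s) i m"
    and "phi_power \<alpha> \<beta> r s (Psi i) (PsiStar m) = 0"
proof -
  have "r > 0" using sep by (rule separates_pos)
  then show "phi_power \<alpha> \<beta> r s (Psi i) (Psi m) =
      (1 - \<alpha> i * \<beta> i) * contour_pairing \<alpha> \<beta> r (- s) i m"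
    unfolding phi_power.simps termwise_integral_def scale_def contour_pairing_def psi_field_apply
    by (intro arg_cong[where f = "\<lambda>x. _ * x"] contour_integral_cong) (auto simp: mult_ac)
  show "phi_power \<alpha> \<beta> r s (Psi i) (PsiStar m) = 0"
    by (simp add: termwise_integral_def scale_def psi_field_apply)
qed

text \<open>
  The same integrand appears with the two indices exchanged. The factor $1-\alpha_m\beta_m$ sits in
  the field and hence under the integral; taking it out requires integrability, that is, continuity
  on the circle.
\<close>

lemma phi_power_PsiStar_apply:
  assumes sep: "separates r \<alpha> \<beta>"
  shows "phi_power \<alpha> \<beta> r s (PsiStar i) (PsiStar m) =
      (1 - \<alpha> m * \<beta> m) * contour_pairing \<alpha> \<beta> r s m i"
    and "phi_power \<alpha> \<beta> r s (PsiStar i) (Psi m) = 0"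
proof -
  have "r > 0" using sep by (rule separates_pos)
  let ?f = "\<lambda>z. z powi s * (pow_alpha z \<alpha> (m - 1) / pow_alpha z \<alpha> i) *
    (pow_beta z \<beta> (i - 1) / pow_beta z \<beta> m) / (2 * of_real pi * \<i>)"
  have nza: "1 - z * \<alpha> k \<noteq> 0" if "z \<in> sphere 0 r" for z k
    using separates_alpha_factor[OF sep] that by simp
  have nzb: "z - \<beta> k \<noteq> 0" if "z \<in> sphere 0 r" for z k
    using separates_beta_factor[OF sep] that by simp
  have "continuous_on (sphere 0 r) ?f"
    unfolding pow_alpha_eq_signed_prod pow_beta_eq_signed_prod
    using nza nzb \<open>r > 0\<close>
    by (intro continuous_intros continuous_on_signed_prod ballI signed_prod_nonzero) auto
  then have "?f contour_integrable_on circlepath 0 r"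
    using \<open>r > 0\<close> by (intro contour_integrable_continuous_circlepath) simp
  then have "(1 - \<alpha> m * \<beta> m) * contour_pairing \<alpha> \<beta> r s m i =
      contour_integral (circlepath 0 r) (\<lambda>z. (1 - \<alpha> m * \<beta> m) * ?f z)"
    unfolding contour_pairing_def by (rule contour_integral_lmul[symmetric])
  also have "\<dots> = phi_power \<alpha> \<beta> r s (PsiStar i) (PsiStar m)"
    unfolding phi_power.simps termwise_integral_def scale_def psi_star_field_apply
    by (intro contour_integral_cong) (auto simp: mult_ac)
  finally show "phi_power \<alpha> \<beta> r s (PsiStar i) (PsiStar m) =
      (1 - \<alpha> m * \<beta> m) * contour_pairing \<alpha> \<beta> r s m i" ..
  show "phi_power \<alpha> \<beta> r s (PsiStar i) (Psi m) = 0"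
    by (simp add: termwise_integral_def scale_def psi_star_field_apply)
qed

theorem proposition4p9:
  fixes \<alpha> \<beta> :: "int \<Rightarrow> complex" and r :: real
  assumes "\<forall>\<^sub>F i in at_bot. \<alpha> i = 0"
    and "\<forall>\<^sub>F i in at_top. \<beta> i = 0"
    and "\<And>i. norm (\<beta> i) < r"
    and "\<And>j. \<alpha> j \<noteq> 0 \<Longrightarrow> r < norm (inverse (\<alpha> j))"
  shows "\<forall>i.
     phi \<alpha> \<beta> r (Psi i) =
       \<alpha> i *\<^sub>F psi i + (1 - \<alpha> i * \<beta> i) *\<^sub>F
         formal_sum (\<lambda>j::nat. (\<Prod>k=1..j. - \<beta> (i + int k)) *\<^sub>F psi (i + int j + 1))
   \<and> phi_inv \<alpha> \<beta> r (Psi i) =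
       \<beta> i *\<^sub>F psi i + (1 - \<alpha> i * \<beta> i) *\<^sub>F
         formal_sum (\<lambda>j::nat. (\<Prod>k=1..j. - \<alpha> (i - int k)) *\<^sub>F psi (i - int j - 1))
   \<and> phi \<alpha> \<beta> r (PsiStar i) =
       \<beta> i *\<^sub>F psi_star i +
         formal_sum (\<lambda>j::nat. ((\<Prod>k=1..j. - \<alpha> (i + int k)) *
           (1 - \<alpha> (i + int j + 1) * \<beta> (i + int j + 1))) *\<^sub>F psi_star (i + int j + 1))
   \<and> phi_inv \<alpha> \<beta> r (PsiStar i) =
       \<alpha> i *\<^sub>F psi_star i +
         formal_sum (\<lambda>j::nat. ((\<Prod>k=1..j. - \<beta> (i - int k)) *
           (1 - \<alpha> (i - int j - 1) * \<beta> (i - int j - 1))) *\<^sub>F psi_star (i - int j - 1))"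
proof (intro allI conjI ext)
  fix i :: int and g :: generator
  have "r > 0"
    using assms(3)[of 0] by (meson norm_ge_zero order_le_less_trans)
  then have sep: "separates r \<alpha> \<beta>"
    using assms(3,4) unfolding separates_def
    by (metis inverse_inverse_eq norm_inverse norm_zero positive_imp_inverse_positive
        less_imp_inverse_less zero_less_norm_iff inverse_positive_imp_positive)
  have nz: "\<alpha> k * \<beta> k \<noteq> 1" for k
    using separates_prod_nonzero[OF sep, of k] by simp
  note coeffs = phi_power_Psi_apply[OF sep] phi_power_PsiStar_apply[OF sep]
    contour_pairing_minus_one[OF sep] contour_pairing_one[OF sep]
    inj_generator[THEN formal_sum_ascending] inj_generator[THEN formal_sum_descending]
    prod_ascending[unfolded One_nat_def, where f = "\<lambda>k. - \<beta> k"]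
    prod_ascending[unfolded One_nat_def, where f = "\<lambda>k. - \<alpha> k"]
    prod_descending[unfolded One_nat_def, where f = "\<lambda>k. - \<alpha> k"]
    prod_descending[unfolded One_nat_def, where f = "\<lambda>k. - \<beta> k"] scale_apply nz
  have outside: "formal_sum (\<lambda>j. c j *\<^sub>F psi (e j)) (PsiStar m) = 0"
    "formal_sum (\<lambda>j. c j *\<^sub>F psi_star (e j)) (Psi m) = 0" for c :: "nat \<Rightarrow> complex" and e m
    by (auto intro!: formal_sum_single_outside)
  show "phi \<alpha> \<beta> r (Psi i) g =
      (\<alpha> i *\<^sub>F psi i + (1 - \<alpha> i * \<beta> i) *\<^sub>F
         formal_sum (\<lambda>j::nat. (\<Prod>k=1..j. - \<beta> (i + int k)) *\<^sub>F psi (i + int j + 1))) g"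
    by (cases g) (auto simp: coeffs outside single_apply simp del: phi_power.simps)
  show "phi_inv \<alpha> \<beta> r (Psi i) g =
      (\<beta> i *\<^sub>F psi i + (1 - \<alpha> i * \<beta> i) *\<^sub>F
         formal_sum (\<lambda>j::nat. (\<Prod>k=1..j. - \<alpha> (i - int k)) *\<^sub>F psi (i - int j - 1))) g"
    by (cases g) (auto simp: coeffs outside single_apply simp del: phi_power.simps)
  show "phi \<alpha> \<beta> r (PsiStar i) g =
      (\<beta> i *\<^sub>F psi_star i +
         formal_sum (\<lambda>j::nat. ((\<Prod>k=1..j. - \<alpha> (i + int k)) *
           (1 - \<alpha> (i + int j + 1) * \<beta> (i + int j + 1))) *\<^sub>F psi_star (i + int j + 1))) g"
    by (cases g) (auto simp: coeffs outside single_apply simp del: phi_power.simps)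
  show "phi_inv \<alpha> \<beta> r (PsiStar i) g =
      (\<alpha> i *\<^sub>F psi_star i +
         formal_sum (\<lambda>j::nat. ((\<Prod>k=1..j. - \<beta> (i - int k)) *
           (1 - \<alpha> (i - int j - 1) * \<beta> (i - int j - 1))) *\<^sub>F psi_star (i - int j - 1))) g"
    by (cases g) (auto simp: coeffs outside single_apply simp del: phi_power.simps)
qed

end
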